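(* Let $q$ be an odd prime power, let $t\ge 3$ be an integer, and let $$\psi(x)=\frac12\bigl(x^{q}+x^{q^{t-1}}-x^{q^{t+1}}+x^{q^{2t-1}}\bigr)\in\mathbb{F}_{q^{2t}}[x].$$ For $1\le k<2t$, the $k$-fold composition $\psi^{(k)}(x)$ is a scattered $q$-polynomial over $\mathbb{F}_{q^{2t}}$ if and only if one of the following holds: (i) $t$ is even and $\gcd(k,t)=1$; or (ii) $t$ is odd, $\gcd(k,2t)=1$, and $q\equiv 1\pmod 4$.
   Context: $\mathbb{F}_{q^n}$ is the finite field with $q^n$ elements. A $q$-polynomial over $\mathbb{F}_{q^n}$ is a polynomial of the form $\sum_i c_i x^{q^i}$ with $c_i\in\mathbb{F}_{q^n}$; $q$-polynomials are regarded as $\mathbb{F}_q$-linear maps $\mathbb{F}_{q^n}\to\mathbb{F}_{q^n}$, i.e. reduced modulo $x^{q^n}-x$. $\psi^{(k)}=\psi\circ\psi\circ\cdots\circ\psi$ ($k$ factors). A $q$-polynomial $f(x)\in\mathbb{F}_{q^n}[x]$ is scattered if for every $m\in\mathbb{F}_{q^n}$ the polynomial $f(x)+mx$ has at most $q$ roots in $\mathbb{F}_{q^n}$; equivalently, for all $y,z\in\mathbb{F}_{q^n}^*$, $f(y)/y=f(z)/z$ implies that $y$ and $z$ are $\mathbb{F}_q$-linearly dependent. Here $n=2t$. *)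

theory Defs
  imports "HOL-Library.Cardinality" "HOL-Computational_Algebra.Computational_Algebra" "HOL-Number_Theory.Prime_Powers" "HOL-Number_Theory.Cong"
begin

definition q_polynomial :: "nat \<Rightarrow> 'a::finite_field poly \<Rightarrow> bool" where
  "q_polynomial q f \<longleftrightarrow> (\<exists>(N::nat) c. f = (\<Sum>i<N. monom (c i) (q ^ i)))"

definition scattered :: "nat \<Rightarrow> 'a::finite_field poly \<Rightarrow> bool" where
  "scattered q f \<longleftrightarrow>
     q_polynomial q f \<and> (\<forall>m. card {x. poly (f + smult m [:0, 1:]) x = 0} \<le> q)"

text \<open>
  Polynomials are regarded as self-maps of the field, so composition is taken
  modulo \<open>x ^ CARD('a) - x\<close>.
\<close>

definition comp_red :: "'a::finite_field poly \<Rightarrow> 'a poly \<Rightarrow> 'a poly" where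
  "comp_red f g = (f \<circ>\<^sub>p g) mod (monom 1 CARD('a) - monom 1 1)"

text \<open>The \<open>k\<close>-fold composition; \<open>[:0, 1:]\<close> is the identity map.\<close>

definition comp_iter :: "nat \<Rightarrow> 'a::finite_field poly \<Rightarrow> 'a poly" where
  "comp_iter k f = (comp_red f ^^ k) [:0, 1:]"

definition psi :: "nat \<Rightarrow> nat \<Rightarrow> 'a::finite_field poly" where
  "psi q t = smult (1 / 2)
     (monom 1 q + monom 1 (q ^ (t - 1)) - monom 1 (q ^ (t + 1)) + monom 1 (q ^ (2 * t - 1)))"

end

theory Submission
  imports Defs
begin

text \<open>
  Write \<open>\<sigma>\<close> for the Frobenius map \<open>x \<mapsto> x ^ q\<close> of the field with \<open>q ^ (2 * t)\<close> elements, and put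
  \<open>\<tau> = \<sigma> ^ t\<close>. Since \<open>\<tau>\<close> is an involution and \<open>2 \<noteq> 0\<close>, the field is the direct sum of the eigenspaces
  \<open>A\<close> (\<open>\<tau> u = u\<close>, the subfield with \<open>q ^ t\<close> elements) and \<open>W\<close> (\<open>\<tau> v = - v\<close>). The four monomials of
  \<open>\<psi>\<close> combine so that \<open>\<psi>\<close> is \<open>\<sigma>\<close> inverse on \<open>A\<close> and \<open>\<sigma>\<close> on \<open>W\<close>. With \<open>\<phi> = \<sigma> ^ k\<close>, the \<open>k\<close>-th
  iterate therefore sends \<open>\<phi> c + w\<close>, where \<open>c\<close> is in \<open>A\<close> and \<open>w\<close> in \<open>W\<close>, to \<open>c + \<phi> w\<close>
  (\<open>psi_map_add\<close>, \<open>poly_comp_iter_psi\<close>). The two alternatives of the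
  theorem amount to \<open>gcd k (2 * t) = 1\<close> together with: \<open>t\<close> is even or \<open>q\<close> is \<open>1\<close> modulo \<open>4\<close>; for even \<open>t\<close>,
  \<open>gcd k t = 1\<close> already forces \<open>k\<close> to be odd.

  Necessity. The iterate is the identity on the fixed field of \<open>\<sigma> ^ g\<close>, \<open>g = gcd k (2 * t)\<close>, which has
  \<open>q ^ g\<close> elements (\<open>not_scattered_if_common_factor\<close>). If \<open>t\<close> and \<open>k\<close> are odd and \<open>q\<close> is \<open>3\<close> modulo \<open>4\<close>, a
  square root \<open>i\<close> of \<open>- 1\<close> lies in \<open>W\<close>, and all \<open>q ^ t\<close> elements \<open>\<phi> c + i * c\<close> with \<open>c\<close> in \<open>A\<close> are
  multiplied by \<open>- i\<close> (\<open>not_scattered_if_3_mod_4\<close>).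

  Sufficiency (\<open>psi_map_proportional\<close>). Suppose that \<open>y = \<phi> c + w\<close> and \<open>z = \<phi> d + v\<close> are multiplied by
  the same factor. Cross-multiplying and separating the \<open>A\<close>-part from the \<open>W\<close>-part gives two equations.
  The \<open>W\<close>-part says that \<open>c * v - d * w\<close> is fixed by \<open>\<phi>\<close>; such an element lies in the field with \<open>q\<close>
  elements, which meets \<open>W\<close> only in \<open>0\<close>. So, for \<open>c \<noteq> 0\<close>, \<open>w = l * c\<close> and \<open>v = l * d\<close> with \<open>l\<close> in \<open>W\<close>,
  and the \<open>A\<close>-part becomes \<open>(1 - l * \<phi> l) * (c * \<phi> d - d * \<phi> c) = 0\<close>. The equation \<open>l * \<phi> l = 1\<close> would put
  \<open>l\<close> into the field with \<open>q\<^sup>2\<close> elements, and the arithmetic conditions exclude this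
  (\<open>antifixed_norm_neq_1\<close>). Hence \<open>d / c\<close> is fixed by \<open>\<phi>\<close>, so that it lies in the field with \<open>q\<close> elements,
  and it equals \<open>z / y\<close>. If \<open>c = 0\<close>, then \<open>d = 0\<close> as well, and the \<open>A\<close>-part says that \<open>z / y = v / w\<close> is fixed
  by \<open>\<phi>\<close>.
\<close>

section \<open>The Frobenius power maps of a finite field\<close>

text \<open>Translation by \<open>1\<close> permutes the field, so \<open>CARD('a)\<close> copies of \<open>1\<close> add up to \<open>0\<close>.\<close>

lemma CHAR_dvd_CARD_finite_field: "CHAR('a::finite_field) dvd CARD('a)"
proof -
  have "(\<Sum>x\<in>UNIV. x + 1 :: 'a) = (\<Sum>x\<in>UNIV. x)"
    by (rule sum.reindex_bij_witness[of _ "\<lambda>x. x - 1" "\<lambda>x. x + 1"]) auto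
  then have "of_nat CARD('a) = (0 :: 'a)" by (simp add: sum.distrib)
  then show ?thesis by (simp add: of_nat_eq_0_iff_char_dvd)
qed

text \<open>
  The argument \<open>F\<close> only carries the type of the field, whose cardinality is tied to \<open>q\<close> and \<open>n\<close>.
\<close>

locale frobenius =
  fixes F :: "'a::finite_field itself" and q n :: nat
  assumes primepow_q: "primepow q" and card_eq: "CARD('a) = q ^ n" and n_pos: "n > 0"
begin

lemma q_gt_1: "q > 1"
  using primepow_q by (rule primepow_gt_Suc_0[unfolded One_nat_def[symmetric]])

lemma q_eq_CHAR_power: "\<exists>e. q = CHAR('a) ^ e"
proof -
  obtain p e where p: "prime p" and q: "q = p ^ e"
    using primepow_q by (auto simp: primepow_def)
  have "CHAR('a) dvd p ^ (e * n)"
    using CHAR_dvd_CARD_finite_field[where ?'a = 'a] by (simp add: card_eq q power_mult)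
  then have "CHAR('a) = p"
    using p prime_CHAR_semidom[where ?'a = 'a] CHAR_pos[where ?'a = 'a]
    by (metis prime_dvd_power primes_dvd_imp_eq)
  then show ?thesis using q by auto
qed

definition frob :: "nat \<Rightarrow> 'a \<Rightarrow> 'a" where
  "frob j x = x ^ (q ^ j)"

lemma frob_0_right [simp]: "frob j 0 = 0"
  using q_gt_1 by (simp add: frob_def)

lemma frob_eq_0_iff [simp]: "frob j x = 0 \<longleftrightarrow> x = 0"
  using q_gt_1 by (simp add: frob_def)

lemma frob_1_right [simp]: "frob j 1 = 1"
  by (simp add: frob_def)

lemma frob_0_left [simp]: "frob 0 x = x"
  by (simp add: frob_def)

lemma frob_mult: "frob j (x * y) = frob j x * frob j y"
  by (simp add: frob_def power_mult_distrib)

lemma frob_divide: "frob j (x / y) = frob j x / frob j y"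
  by (simp add: frob_def power_divide)

lemma frob_frob: "frob i (frob j x) = frob (i + j) x"
  by (simp add: frob_def power_add power_mult[symmetric] mult.commute)

lemma frob_commute: "frob i (frob j x) = frob j (frob i x)"
  by (simp add: frob_frob add.commute)

lemma frob_add: "frob j (x + y) = frob j x + frob j y"
proof -
  obtain e where "q = CHAR('a) ^ e" using q_eq_CHAR_power by blast
  then have "q ^ j = CHAR('a) ^ (e * j)" by (simp add: power_mult)
  then show ?thesis
    unfolding frob_def
    using prime_CHAR_semidom[where ?'a = 'a] CHAR_pos[where ?'a = 'a]
    by (intro freshmans_dream') auto
qed

lemma frob_minus: "frob j (- x) = - frob j x"
  using frob_add[of j "- x" x] by (simp add: eq_neg_iff_add_eq_0)

lemma frob_diff: "frob j (x - y) = frob j x - frob j y"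
  using frob_add[of j x "- y"] by (simp add: frob_minus)

lemma frob_2_right [simp]: "frob j 2 = 2"
  using frob_add[of j 1 1] by simp

lemma frob_period: "frob (n * m) x = x"
  unfolding frob_def by (rule finite_field_power_card_power_eq_same) (simp add: card_eq power_mult)

lemma frob_mod: "frob (j mod n) x = frob j x"
proof -
  have "frob j x = frob (j mod n) (frob (n * (j div n)) x)"
    by (simp add: frob_frob)
  then show ?thesis by (simp add: frob_period)
qed

lemma frob_fixed_mult: "frob (a * m) x = x" if "frob a x = x"
proof (induction m)
  case (Suc m)
  then show ?case using that by (simp flip: frob_frob)
qed simp

lemma frob_fixed_dvd: "frob j x = x" if "frob i x = x" "i dvd j"
  using that frob_fixed_mult by (auto elim: dvdE)

text \<open>By Bezout, the exponents \<open>j\<close> for which \<open>frob j\<close> fixes a given point are closed under gcd.\<close>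

lemma frob_fixed_gcd: "frob (gcd a b) x = x" if a: "frob a x = x" and b: "frob b x = x"
proof (cases "a = 0")
  case False
  then obtain u v where uv: "a * u = b * v + gcd a b"
    using bezout_nat by blast
  have "x = frob (gcd a b + b * v) x"
    using frob_fixed_mult[OF a, of u] by (simp add: uv add.commute)
  also have "\<dots> = frob (gcd a b) x"
    using frob_fixed_mult[OF b] by (simp flip: frob_frob)
  finally show ?thesis by simp
qed (use b in simp)

lemma frob_fixed_gcd_degree: "frob (gcd a n) x = x" if "frob a x = x"
  using that frob_period[of 1] by (intro frob_fixed_gcd) simp_all

lemma card_power_eq_le: "card {x::'a. x ^ m = c} \<le> m" if "m > 0"
proof -
  let ?p = "monom 1 m - [:c:]"
  have deg: "degree ?p = m"
    using that
    by (intro antisym degree_diff_le le_degree) (auto simp: degree_monom_eq coeff_pCons split: nat.splits)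
  then have "?p \<noteq> 0" using that by auto
  then have "card {x. poly ?p x = 0} \<le> m"
    using card_poly_roots_bound[of ?p] deg by simp
  then show ?thesis by (simp add: poly_monom)
qed

lemma card_frob_1_fixed_le: "card {x. frob 1 x = x} \<le> q"
proof -
  have *: "x ^ q = x \<longleftrightarrow> x = 0 \<or> x ^ (q - 1) = 1" for x :: 'a
    using q_gt_1 by (cases q) auto
  have "card {x. frob 1 x = x} \<le> card (insert 0 {x::'a. x ^ (q - 1) = 1})"
    by (intro card_mono) (auto simp: frob_def *)
  also have "\<dots> \<le> Suc (card {x::'a. x ^ (q - 1) = 1})"
    by (rule card_insert_le_m1) auto
  also have "\<dots> \<le> q"
    using card_power_eq_le[of "q - 1" "1::'a"] q_gt_1 by simp
  finally show ?thesis .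
qed

text \<open>
  The norm \<open>x \<mapsto> x ^ M\<close> with \<open>M = (q ^ n - 1) / (q ^ d - 1)\<close> sends nonzero elements to nonzero
  fixed points of \<open>frob d\<close>, and each of its fibres has at most \<open>M\<close> elements.
\<close>

lemma card_frob_fixed_ge:
  assumes "d dvd n" "d > 0"
  shows "q ^ d \<le> card {x. frob d x = x}"
proof -
  obtain e where e: "n = d * e" using assms by blast
  define Q where "Q = q ^ d"
  have Q: "Q > 1" using q_gt_1 assms unfolding Q_def by (intro one_less_power) auto
  define M where "M = (\<Sum>i<e. Q ^ i)"
  have M: "(Q - 1) * M = q ^ n - 1"
  proof -
    have "int ((Q - 1) * M) = (int Q - 1) * (\<Sum>i<e. int Q ^ i)"
      using Q by (simp add: M_def of_nat_diff)
    also have "\<dots> = int Q ^ e - 1" by (rule power_diff_1_eq[symmetric])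
    also have "\<dots> = int (q ^ n - 1)"
      using q_gt_1 by (simp add: of_nat_diff e Q_def power_mult)
    finally show ?thesis by (rule of_nat_eq_iff[THEN iffD1])
  qed
  have N: "q ^ n > 1" using q_gt_1 n_pos by (intro one_less_power) auto
  have "M > 0"
    using M N by (intro Nat.gr0I) auto
  let ?K = "{x. frob d x = x} - {0}"
  have one: "x ^ (q ^ n - 1) = 1" if "x \<noteq> 0" for x :: 'a
  proof -
    have "x * x ^ (q ^ n - 1) = x ^ (q ^ n)"
      using N by (metis Suc_diff_1 less_trans power_Suc zero_less_one)
    also have "\<dots> = x" using finite_field_power_card_eq_same[of x] by (simp add: card_eq)
    finally show ?thesis using that by simp
  qed
  have K: "x ^ M \<in> ?K" if "x \<noteq> 0" for x :: 'a
  proof -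
    have "(x ^ M) ^ Q = x ^ M * (x ^ M) ^ (Q - 1)"
      using Q by (metis Suc_diff_1 less_trans power_Suc zero_less_one)
    also have "(x ^ M) ^ (Q - 1) = x ^ (q ^ n - 1)"
      using M by (simp add: power_mult[symmetric] mult.commute)
    also have "\<dots> = 1" using that by (rule one)
    finally show ?thesis using that by (simp add: frob_def Q_def)
  qed
  have "(Q - 1) * M = card (UNIV - {0::'a})"
    using M by (simp add: card_Diff_singleton card_eq)
  also have "\<dots> \<le> card (\<Union>y\<in>?K. {x. x ^ M = y})"
  proof (rule card_mono)
    show "UNIV - {0} \<subseteq> (\<Union>y\<in>?K. {x. x ^ M = y})"
    proof
      fix x :: 'a assume "x \<in> UNIV - {0}"
      then show "x \<in> (\<Union>y\<in>?K. {x. x ^ M = y})"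
        using K[of x] by (intro UN_I[of "x ^ M"]) simp_all
    qed
  qed simp
  also have "\<dots> \<le> (\<Sum>y\<in>?K. card {x. x ^ M = y})"
    by (rule card_UN_le) auto
  also have "\<dots> \<le> (\<Sum>y\<in>?K. M)"
    by (intro sum_mono card_power_eq_le \<open>M > 0\<close>)
  finally have "Q - 1 \<le> card ?K" using \<open>M > 0\<close> by simp
  also have "card ?K = card {x. frob d x = x} - 1"
    by (simp add: card_Diff_singleton)
  finally show ?thesis
    using Q unfolding Q_def[symmetric] by linarith
qed

text \<open>
  A set in which any two elements have a ratio in the field with \<open>q\<close> elements lies on a line over
  that field.
\<close>

lemma card_proportional_le:
  assumes "\<And>y z. y \<in> S \<Longrightarrow> z \<in> S \<Longrightarrow> y \<noteq> 0 \<Longrightarrow> frob 1 (z / y) = z / y"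
  shows "card S \<le> q"
proof (cases "S \<subseteq> {0}")
  case True
  then have "card S \<le> 1" using card_mono[of "{0}" S] by simp
  then show ?thesis using q_gt_1 by simp
next
  case False
  then obtain y where y: "y \<in> S" "y \<noteq> 0" by blast
  have "S \<subseteq> (\<lambda>c. c * y) ` {c. frob 1 c = c}"
  proof
    fix z assume "z \<in> S"
    then show "z \<in> (\<lambda>c. c * y) ` {c. frob 1 c = c}"
      using y assms by (intro image_eqI[of _ _ "z / y"]) auto
  qed
  then have "card S \<le> card ((\<lambda>c. c * y) ` {c. frob 1 c = c})"
    by (intro card_mono) auto
  also have "\<dots> \<le> card {c. frob 1 c = c}"
    by (intro card_image_le) simp
  also have "\<dots> \<le> q"
    by (rule card_frob_1_fixed_le)
  finally show ?thesis .
qed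

end

section \<open>The iterates as maps\<close>

locale psi_field = frobenius F q "2 * t"
  for F :: "'a::finite_field itself" and q t :: nat +
  assumes odd_q: "odd q"
begin

lemma t_pos: "t > 0"
  using n_pos by simp

lemma two_neq_0 [simp]: "(2 :: 'a) \<noteq> 0"
proof
  assume "(2 :: 'a) = 0"
  then have "CHAR('a) dvd 2"
    using of_nat_eq_0_iff_char_dvd[where ?'a = 'a, of 2] by simp
  then have "CHAR('a) = 2"
    using prime_CHAR_semidom[where ?'a = 'a] CHAR_pos[where ?'a = 'a]
    by (simp add: primes_dvd_imp_eq)
  moreover obtain e where "q = CHAR('a) ^ e" using q_eq_CHAR_power by blast
  ultimately show False using odd_q q_gt_1 by (cases e) auto
qed

lemma minus_eq_self_iff: "- x = x \<longleftrightarrow> x = (0 :: 'a)"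
proof
  assume "- x = x"
  then have "2 * x = 0" by (metis add.right_inverse mult_2)
  then show "x = 0" by simp
qed simp

text \<open>
  The map that is \<open>frob k\<close> inverse on the fixed points of \<open>frob t\<close> and \<open>frob k\<close> on its
  \<open>- 1\<close>-eigenspace: \<open>x \<plusminus> frob t x\<close> is twice the component of \<open>x\<close> in the respective eigenspace. The exponent
  \<open>(2 * t - 1) * k\<close> is congruent to \<open>- k\<close> modulo the order \<open>2 * t\<close> of the Frobenius map; in this form it
  is additive in \<open>k\<close>, which suits induction.
\<close>

definition psi_map :: "nat \<Rightarrow> 'a \<Rightarrow> 'a" where
  "psi_map k x = (frob ((2 * t - 1) * k) (x + frob t x) + frob k (x - frob t x)) / 2"

lemma frob_inverse: "frob k (frob ((2 * t - 1) * k) x) = x"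
proof -
  have "k + (2 * t - 1) * k = 2 * t * k"
    using t_pos by (simp add: algebra_simps)
  then show ?thesis by (simp add: frob_frob frob_period)
qed

lemma frob_inverse': "frob ((2 * t - 1) * k) (frob k x) = x"
  using frob_inverse by (simp add: frob_commute)

lemma frob_t_t: "frob t (frob t x) = x"
  using frob_period[of 1 x] by (simp add: frob_frob mult_2)

lemma psi_map_add:
  assumes "frob t u = u" "frob t v = - v"
  shows "psi_map k (u + v) = frob ((2 * t - 1) * k) u + frob k v"
proof -
  have 1: "u + v + frob t (u + v) = 2 * u" "u + v - frob t (u + v) = 2 * v"
    using assms by (simp_all add: frob_add)
  show ?thesis
    unfolding psi_map_def 1 by (simp add: frob_mult add_divide_distrib)
qed

lemma eigen_decomposition:
  obtains u v where "x = u + v" "frob t u = u" "frob t v = - v"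
proof
  have "x = 2 * x / 2" by simp
  also have "2 * x = (x + frob t x) + (x - frob t x)" by simp
  finally show "x = (x + frob t x) / 2 + (x - frob t x) / 2" by (simp only: add_divide_distrib)
  show "frob t ((x + frob t x) / 2) = (x + frob t x) / 2"
    by (simp add: frob_divide frob_add frob_t_t add.commute)
  show "frob t ((x - frob t x) / 2) = - ((x - frob t x) / 2)"
    by (simp add: frob_divide frob_diff frob_t_t minus_divide_left)
qed

text \<open>The eigenspaces are stable under all powers of the Frobenius map, so exponents add on each.\<close>

lemma psi_map_Suc: "psi_map 1 (psi_map k x) = psi_map (Suc k) x"
proof -
  obtain u v where x: "x = u + v" and uv: "frob t u = u" "frob t v = - v"
    by (rule eigen_decomposition)
  have "frob t (frob j u) = frob j u" "frob t (frob j v) = - frob j v" for j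
    using uv by (simp_all add: frob_commute[of t] frob_minus)
  then have "psi_map 1 (psi_map k x) =
      frob ((2 * t - 1) * 1) (frob ((2 * t - 1) * k) u) + frob 1 (frob k v)"
    unfolding x psi_map_add[OF uv] by (intro psi_map_add)
  also have "\<dots> = psi_map (Suc k) x"
    unfolding x psi_map_add[OF uv] frob_frob by simp
  finally show ?thesis .
qed

lemma psi_map_0: "psi_map 0 x = x"
  by (simp add: psi_map_def)

lemma poly_psi: "poly (psi q t) x = psi_map 1 x"
proof -
  have "frob (2 * t - 1) (frob t x) = frob (t - 1) (frob (2 * t) x)"
    using t_pos by (simp add: frob_frob)
  then have *: "frob (2 * t - 1) (frob t x) = frob (t - 1) x"
    using frob_period[of 1] by simp
  show ?thesis
    unfolding psi_map_def mult_1_right frob_add frob_diff *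
    unfolding frob_frob
    by (simp add: psi_def poly_monom frob_def add.commute)
qed

lemma poly_comp_red: "poly (comp_red f g) x = poly f (poly g x)" for f g :: "'a poly"
proof -
  let ?m = "monom 1 CARD('a) - monom 1 1 :: 'a poly"
  have "poly ?m x = 0"
    by (simp add: poly_monom finite_field_power_card_eq_same)
  then show ?thesis
    unfolding comp_red_def by (simp add: poly_mod poly_pcompose)
qed

lemma poly_comp_iter_psi: "poly (comp_iter k (psi q t)) x = psi_map k x"
proof (induction k)
  case 0
  then show ?case by (simp add: comp_iter_def psi_map_0)
next
  case (Suc k)
  then show ?case
    by (simp add: comp_iter_def poly_comp_red poly_psi psi_map_Suc[unfolded One_nat_def])
qed

lemma degree_comp_red: "degree (comp_red f g) < CARD('a)" for f g :: "'a poly"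
proof -
  let ?m = "monom 1 CARD('a) - monom 1 1 :: 'a poly"
  have C: "CARD('a) > 1"
    using q_gt_1 t_pos unfolding card_eq by (intro one_less_power) auto
  then have d: "degree ?m = CARD('a)"
    by (intro antisym degree_diff_le le_degree) (auto simp: degree_monom_eq)
  then have "?m \<noteq> 0" using C by auto
  then have "comp_red f g = 0 \<or> degree (comp_red f g) < degree ?m"
    unfolding comp_red_def by (rule degree_mod_less)
  then show ?thesis using C d by auto
qed

end

section \<open>The iterates as \<open>q\<close>-polynomials\<close>

lemma q_polynomial_monom: "q_polynomial q (monom c (q ^ j))"
  unfolding q_polynomial_def
proof (intro exI)
  have "(\<Sum>i<Suc j. monom (if i = j then c else 0) (q ^ i)) =
        (\<Sum>i<Suc j. if i = j then monom c (q ^ i) else 0)"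
    by (rule sum.cong) auto
  then show "monom c (q ^ j) = (\<Sum>i<Suc j. monom (if i = j then c else 0) (q ^ i))"
    by simp
qed

lemma q_polynomial_add:
  assumes "q_polynomial q f" "q_polynomial q g"
  shows "q_polynomial q (f + g)"
proof -
  obtain N c M d where f: "f = (\<Sum>i<N. monom (c i) (q ^ i))"
    and g: "g = (\<Sum>i<M. monom (d i) (q ^ i))"
    using assms unfolding q_polynomial_def by blast
  have pad: "(\<Sum>i<N. monom (c i) (q ^ i)) =
      (\<Sum>i<L. monom (if i < N then c i else 0) (q ^ i))" if "N \<le> L" for N L c
    using that by (intro sum.mono_neutral_cong_left) auto
  have "f + g = (\<Sum>i<max N M. monom ((if i < N then c i else 0) + (if i < M then d i else 0)) (q ^ i))"
    unfolding f g by (simp add: pad[of N "max N M"] pad[of M "max N M"] add_monom[symmetric] sum.distrib)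
  then show ?thesis unfolding q_polynomial_def
    by (intro exI[of _ "max N M"] exI)
qed

context psi_field
begin

text \<open>
  A polynomial of degree below the order of the field is determined by its values. The iterate, being
  reduced, thus equals the polynomial obtained from \<open>psi_map\<close> by reducing the exponents of the
  Frobenius map modulo \<open>2 * t\<close>; polynomial compositions need not be expanded.
\<close>

lemma q_polynomial_comp_iter_psi:
  assumes "k \<ge> 1"
  shows "q_polynomial q (comp_iter k (psi q t :: 'a poly))"
proof -
  define j where "j i = i mod (2 * t)" for i
  define g :: "'a poly" where
    "g = monom (1/2) (q ^ j ((2 * t - 1) * k)) + monom (1/2) (q ^ j ((2 * t - 1) * k + t))
       + monom (1/2) (q ^ j k) + monom (-1/2) (q ^ j (k + t))"
  have qp: "q_polynomial q g"
    unfolding g_def by (intro q_polynomial_add q_polynomial_monom)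
  have val: "poly g x = psi_map k x" for x
  proof -
    have "x ^ (q ^ j i) = frob i x" for i
      using frob_mod[of i x] by (simp add: frob_def j_def)
    then show ?thesis
      by (simp add: g_def poly_monom psi_map_def frob_add frob_diff frob_frob
            add_divide_distrib diff_divide_distrib)
  qed
  have "q ^ j i < CARD('a)" for i
    using q_gt_1 t_pos unfolding card_eq j_def by (intro power_strict_increasing) auto
  then have deg_m: "degree (monom c (q ^ j i)) < CARD('a)" for c :: 'a and i
    by (meson degree_monom_le le_less_trans)
  have deg_g: "degree g < CARD('a)"
    unfolding g_def by (intro degree_add_less deg_m)
  obtain k' where "k = Suc k'" using assms by (cases k) auto
  then have "degree (comp_iter k (psi q t :: 'a poly)) < CARD('a)"
    using degree_comp_red by (simp add: comp_iter_def)
  then have "comp_iter k (psi q t) = g"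
    using deg_g by (intro poly_eqI_degree[of UNIV]) (auto simp: poly_comp_iter_psi val)
  then show ?thesis using qp by simp
qed

lemma scattered_comp_iter_psi_iff:
  assumes "k \<ge> 1"
  shows "scattered q (comp_iter k (psi q t :: 'a poly)) \<longleftrightarrow>
           (\<forall>m. card {x. psi_map k x + m * x = 0} \<le> q)"
  unfolding scattered_def using q_polynomial_comp_iter_psi[OF assms]
  by (simp add: poly_comp_iter_psi mult.commute)

section \<open>Obstructions to being scattered\<close>

text \<open>
  On the fixed field of \<open>frob g\<close> both \<open>frob k\<close> and its inverse are the identity, so \<open>psi_map k\<close> adds up
  the two components of each point unchanged; \<open>m = - 1\<close> then has at least \<open>q ^ g\<close> roots.
\<close>

lemma not_scattered_if_common_factor:
  assumes "gcd k (2 * t) \<noteq> 1"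
  shows "\<exists>m. card {x. psi_map k x + m * x = 0} > q"
proof -
  define g where "g = gcd k (2 * t)"
  have g: "g > 1" "g dvd k" "g dvd 2 * t"
    using assms t_pos by (auto simp: g_def nat_neq_iff)
  have "psi_map k x = x" if x: "frob g x = x" for x
  proof -
    have fixed: "frob j y = y" if "g dvd j" "frob g y = y" for j y
      using that frob_fixed_dvd by blast
    have t: "frob g (frob t x) = frob t x" using x by (simp add: frob_commute[of g t])
    show ?thesis
      unfolding psi_map_def
      using g x t by (simp add: fixed frob_add frob_diff)
  qed
  then have "{x. frob g x = x} \<subseteq> {x. psi_map k x + (- 1) * x = 0}" by auto
  then have "card {x. frob g x = x} \<le> card {x. psi_map k x + (- 1) * x = 0}"
    by (intro card_mono) auto
  moreover have "q ^ g \<le> card {x. frob g x = x}"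
    using g by (intro card_frob_fixed_ge) auto
  moreover have "q < q ^ g"
    using power_strict_increasing[of 1 g q] g q_gt_1 by simp
  ultimately show ?thesis by (intro exI[of _ "- 1"]) linarith
qed

text \<open>
  The order of the field is a square of an odd number, hence of the form \<open>4 * r + 1\<close>. Not every nonzero
  element is a root of \<open>X ^ (2 * r) - 1\<close>; for any other nonzero \<open>x\<close>, the power \<open>x ^ (2 * r)\<close> is \<open>- 1\<close>.
\<close>

lemma ex_sqrt_minus_1: "\<exists>i::'a. i\<^sup>2 = - 1"
proof -
  let ?N = "CARD('a)"
  have sq: "?N = (q ^ t)\<^sup>2"
    by (simp add: card_eq power_mult mult.commute)
  have "[(q ^ t)\<^sup>2 = 1] (mod 4)"
  proof -
    obtain b where b: "q ^ t = 2 * b + 1" using odd_q by (metis oddE even_power)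
    have "(q ^ t)\<^sup>2 = 4 * (b * b + b) + 1" by (simp add: b power2_eq_square)
    then show ?thesis by (simp add: cong_def)
  qed
  then have "?N mod 4 = 1" by (simp add: sq cong_def)
  then obtain r where r: "?N = 4 * r + 1"
    by (metis mult_div_mod_eq)
  have "r > 0" using r q_gt_1 t_pos by (cases r) (auto simp: card_eq)
  have pow: "x ^ (4 * r) = 1" if "x \<noteq> 0" for x :: 'a
    using that finite_field_power_card_eq_same[of x] by (simp add: r)
  have "\<exists>x::'a. x \<noteq> 0 \<and> x ^ (2 * r) \<noteq> 1"
  proof (rule ccontr)
    assume "\<not> ?thesis"
    then have "card (UNIV - {0::'a}) \<le> card {x::'a. x ^ (2 * r) = 1}"
      by (intro card_mono) auto
    also have "\<dots> \<le> 2 * r" using \<open>r > 0\<close> by (intro card_power_eq_le) auto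
    finally show False using \<open>r > 0\<close> by (simp add: r card_Diff_singleton)
  qed
  then obtain x :: 'a where x: "x \<noteq> 0" "x ^ (2 * r) \<noteq> 1" by blast
  have "(x ^ (2 * r))\<^sup>2 = 1"
    using pow[OF x(1)] by (simp add: power_mult[symmetric])
  then have "x ^ (2 * r) = - 1"
    using x(2) by (simp add: power2_eq_1_iff)
  then have "(x ^ r)\<^sup>2 = - 1"
    by (simp add: power_mult[symmetric] mult.commute)
  then show ?thesis by blast
qed

lemma frob_odd_sqrt_minus_1:
  assumes i: "i\<^sup>2 = - 1" and q: "q mod 4 = 3" and j: "odd j"
  shows "frob j i = - i"
proof -
  obtain s where s: "q = 4 * s + 3" using q by (metis mult_div_mod_eq)
  have i4: "i ^ 4 = 1"
    using i power_mult[of i 2 2] by simp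
  have "i ^ q = (i ^ 4) ^ s * (i\<^sup>2 * i)"
    unfolding s power_add power_mult by (simp add: power2_eq_square power3_eq_cube)
  then have 1: "frob 1 i = - i"
    by (simp add: frob_def i i4)
  then have 2: "frob 2 i = i"
    using frob_frob[of 1 1 i] by (simp add: frob_minus numeral_2_eq_2)
  obtain b where "j = 2 * b + 1" using j by (rule oddE)
  then have "frob j i = frob 1 (frob (2 * b) i)" by (simp add: frob_frob)
  then show ?thesis using frob_fixed_mult[OF 2] 1 by simp
qed

text \<open>
  The witness is \<open>m = i\<close> with \<open>i\<^sup>2 = - 1\<close>. As \<open>frob t\<close> and \<open>frob k\<close> both negate \<open>i\<close>, the point
  \<open>frob k c + i * c\<close> is sent to \<open>c - i * frob k c = - i * (frob k c + i * c)\<close> for each fixed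
  point \<open>c\<close> of \<open>frob t\<close>.
\<close>

lemma not_scattered_if_3_mod_4:
  assumes "odd t" "odd k" "q mod 4 = 3" "t > 1"
  shows "\<exists>m. card {x. psi_map k x + m * x = 0} > q"
proof -
  obtain i :: 'a where i: "i\<^sup>2 = - 1" using ex_sqrt_minus_1 by blast
  have ij: "frob j i = - i" if "odd j" for j
    using frob_odd_sqrt_minus_1[OF i] assms that by blast
  define y where "y c = frob k c + i * c" for c
  let ?A = "{c. frob t c = c}"
  have sol: "psi_map k (y c) + i * y c = 0" if c: "c \<in> ?A" for c
  proof -
    have "psi_map k (y c) = c - i * frob k c"
      unfolding y_def
      using c assms psi_map_add[of "frob k c" "i * c" k]
      by (simp only: frob_inverse' frob_commute[of t k]) (simp add: frob_mult ij)
    then show ?thesis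
      using i by (simp add: y_def algebra_simps power2_eq_square flip: mult.assoc)
  qed
  have inj: "inj_on y ?A"
  proof (rule inj_onI)
    fix c d assume cd: "c \<in> ?A" "d \<in> ?A" "y c = y d"
    define e where "e = c - d"
    have te: "frob t e = e" using cd by (simp add: e_def frob_diff)
    have e: "frob k e = - (i * e)"
      using cd(3) by (simp add: y_def e_def frob_diff algebra_simps)
    \<comment> \<open>\<open>frob t\<close> fixes \<open>frob k e\<close> but negates the equal element \<open>- (i * e)\<close>.\<close>
    have "frob k e = frob t (frob k e)" using te by (simp add: frob_commute[of t])
    also have "\<dots> = i * e"
      using te assms by (simp add: e frob_minus frob_mult ij)
    finally have "- (i * e) = i * e" using e by simp
    then have "i * e = 0" by (simp only: minus_eq_self_iff)
    moreover have "i \<noteq> 0" using i by auto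
    ultimately show "c = d" by (simp add: e_def)
  qed
  have "q < q ^ t"
    using power_strict_increasing[of 1 t q] assms q_gt_1 by simp
  also have "\<dots> \<le> card ?A"
    using t_pos by (intro card_frob_fixed_ge) auto
  also have "\<dots> = card (y ` ?A)" using inj by (simp add: card_image)
  also have "\<dots> \<le> card {x. psi_map k x + i * x = 0}"
    using sol by (intro card_mono) auto
  finally show ?thesis by blast
qed

section \<open>Proportionality of points with a common factor\<close>

lemma odd_if_coprime_double:
  fixes a b :: nat
  assumes "gcd a (2 * b) = 1"
  shows "odd a"
  using assms by (metis dvd_triv_left gcd_greatest odd_one)

lemma frob_fixed_antifixed_eq_0:
  assumes "gcd k (2 * t) = 1" "frob k x = x" "frob t x = - x"
  shows "x = 0"
proof -
  have "frob 1 x = x" using frob_fixed_gcd_degree[OF assms(2)] assms(1) by simp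
  then have "frob t x = x" using frob_fixed_mult[of 1 x t] by simp
  then show ?thesis using assms(3) minus_eq_self_iff by simp
qed

text \<open>
  The equation says that \<open>frob k\<close> inverts \<open>l\<close>, so \<open>frob (2 * k)\<close> fixes it, and so does
  \<open>frob (gcd (2 * k) (2 * t)) = frob 2\<close>. If \<open>t\<close> is even, \<open>frob t\<close> fixes \<open>l\<close> as well, against the
  hypothesis. If \<open>t\<close> is odd, then \<open>k\<close> is odd too, so that \<open>frob k\<close> and \<open>frob t\<close> agree on \<open>l\<close>; this gives
  \<open>l\<^sup>2 = - 1\<close>, and for \<open>q = 4 * s + 1\<close> the power \<open>l ^ q\<close> is \<open>l\<close> rather than \<open>- l\<close>.
\<close>

lemma antifixed_norm_neq_1:
  assumes coprime: "gcd k (2 * t) = 1" and q: "even t \<or> q mod 4 = 1"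
    and l: "frob t l = - l"
  shows "l * frob k l \<noteq> 1"
proof
  assume eq: "l * frob k l = 1"
  then have l0: "l \<noteq> 0" by auto
  have "frob k l = 1 / l"
    using eq l0 by (simp add: field_simps)
  then have "frob k (frob k l) = l"
    by (simp add: frob_divide)
  then have "frob (2 * k) l = l"
    by (simp add: frob_frob mult_2)
  moreover have "gcd (2 * k) (2 * t) = 2"
  proof -
    have "gcd k t = 1"
      using coprime by (metis coprime_iff_gcd_eq_1 coprime_mult_right_iff)
    then show ?thesis by (metis gcd_mult_distrib_nat mult.right_neutral)
  qed
  ultimately have 2: "frob 2 l = l"
    using frob_fixed_gcd_degree[of "2 * k" l] by simp
  have frob_odd: "frob j l = frob 1 l" if j: "odd j" for j
  proof -
    obtain b where "j = 2 * b + 1" using j by (rule oddE)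
    then have "frob j l = frob 1 (frob (2 * b) l)" by (simp add: frob_frob)
    then show ?thesis using frob_fixed_mult[OF 2] by simp
  qed
  show False
  proof (cases "even t")
    case True
    then have "frob t l = l" using frob_fixed_dvd[OF 2] by blast
    then show False using l l0 minus_eq_self_iff by simp
  next
    case False
    have "odd k"
      using coprime by (rule odd_if_coprime_double)
    have f1: "frob 1 l = - l" using frob_odd[OF False] l by simp
    have "frob k l = - l" using frob_odd[OF \<open>odd k\<close>] f1 by simp
    then have l2: "l\<^sup>2 = - 1"
      using eq by (simp add: power2_eq_square minus_equation_iff)
    have l4: "l ^ 4 = 1"
      using l2 power_mult[of l 2 2] by simp
    obtain s where s: "q = 4 * s + 1" using q False by (metis mult_div_mod_eq)
    have "frob 1 l = (l ^ 4) ^ s * l"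
      unfolding frob_def unfolding s by (simp add: power_add power_mult)
    then show False using f1 l4 l0 minus_eq_self_iff by simp
  qed
qed

text \<open>
  In the coordinates \<open>x = frob k c + w\<close> the map is \<open>c + frob k w\<close>, free of inverses. Below, \<open>E'\<close> is the
  image of the cross-multiplied equation \<open>E\<close> under \<open>frob t\<close>; their sum and difference are the parts in the
  two eigenspaces.
\<close>

lemma psi_map_proportional:
  assumes coprime: "gcd k (2 * t) = 1" and q: "even t \<or> q mod 4 = 1"
    and y0: "y \<noteq> 0" and eq: "psi_map k y * z = psi_map k z * y"
  shows "frob 1 (z / y) = z / y"
proof -
  have coords: "\<exists>c w. frob t c = c \<and> frob t w = - w \<and>
      x = frob k c + w \<and> psi_map k x = c + frob k w" for x
  proof -
    obtain u v where uv: "x = u + v" "frob t u = u" "frob t v = - v"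
      by (rule eigen_decomposition)
    show ?thesis
      by (rule exI[of _ "frob ((2 * t - 1) * k) u"], rule exI[of _ v])
         (use uv in \<open>simp add: psi_map_add frob_inverse[unfolded One_nat_def] frob_commute[of t]\<close>)
  qed
  obtain c w where c: "frob t c = c" and w: "frob t w = - w"
    and y: "y = frob k c + w" "psi_map k y = c + frob k w" using coords by blast
  obtain d v where d: "frob t d = d" and v: "frob t v = - v"
    and z: "z = frob k d + v" "psi_map k z = d + frob k v" using coords by blast
  have E: "(c + frob k w) * (frob k d + v) = (d + frob k v) * (frob k c + w)"
    using eq unfolding y(2) z(2) by (simp only: y(1) z(1))
  have E': "(c - frob k w) * (frob k d - v) = (d - frob k v) * (frob k c - w)"
    using arg_cong[OF E, of "frob t"] c w d v
    by (simp add: frob_mult frob_add frob_commute[of t k] frob_minus)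
  have A: "c * frob k d + frob k w * v = d * frob k c + frob k v * w"
  proof -
    have "2 * (c * frob k d + frob k w * v) = 2 * (d * frob k c + frob k v * w)"
      using arg_cong2[OF E E', of "(+)"] by (simp add: algebra_simps)
    then show ?thesis by (simp only: mult_cancel_left two_neq_0 simp_thms)
  qed
  have B: "c * v - d * w = frob k (c * v - d * w)"
  proof -
    have "2 * (c * v + frob k w * frob k d) = 2 * (d * w + frob k v * frob k c)"
      using arg_cong2[OF E E', of "(-)"] by (simp add: algebra_simps)
    then have "c * v + frob k w * frob k d = d * w + frob k v * frob k c"
      by (simp only: mult_cancel_left two_neq_0 simp_thms)
    then show ?thesis by (simp add: frob_diff frob_mult algebra_simps)
  qed
  have "frob t (c * v - d * w) = - (c * v - d * w)"
    using c d v w by (simp add: frob_diff frob_mult)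
  then have "c * v - d * w = 0"
    by (rule frob_fixed_antifixed_eq_0[OF coprime B[symmetric]])
  then have cv: "c * v = d * w" by simp
  have fixed: "frob 1 e = e" if "frob k e = e" for e
    using frob_fixed_gcd_degree[OF that] coprime by simp
  show ?thesis
  proof (cases "c = 0")
    case True
    then have w0: "w \<noteq> 0" using y0 y by auto
    then have "d = 0" using cv True by simp
    then have "frob k (v / w) = v / w"
      using A True w0 by (simp add: frob_divide field_simps)
    then show ?thesis using fixed True \<open>d = 0\<close> by (simp add: y z)
  next
    case False
    define l where "l = w / c"
    have wl: "w = l * c" and vl: "v = l * d"
      using False cv by (simp_all add: l_def field_simps)
    have "frob t l = - l" using c w by (simp add: l_def frob_divide)
    then have "1 - l * frob k l \<noteq> 0"
      using antifixed_norm_neq_1[OF coprime q, of l] by simp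
    moreover have "(1 - l * frob k l) * (c * frob k d - d * frob k c) = 0"
      using A by (simp add: wl vl frob_mult algebra_simps)
    ultimately have ratio: "c * frob k d = d * frob k c" by simp
    define e where "e = d / c"
    have "frob k e = e"
      using ratio False by (simp add: e_def frob_divide field_simps)
    moreover have "d = e * c" using False by (simp add: e_def)
    ultimately have "z = e * y"
      by (simp add: y z wl vl frob_mult algebra_simps)
    then show ?thesis using y0 fixed \<open>frob k e = e\<close> by simp
  qed
qed

lemma scattered_if_coprime:
  assumes "gcd k (2 * t) = 1" "even t \<or> q mod 4 = 1"
  shows "card {x. psi_map k x + m * x = 0} \<le> q"
proof (rule card_proportional_le)
  fix y z assume yz: "y \<in> {x. psi_map k x + m * x = 0}" "z \<in> {x. psi_map k x + m * x = 0}"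
    and "y \<noteq> 0"
  then have "psi_map k y = - (m * y)" "psi_map k z = - (m * z)"
    by (simp_all add: eq_neg_iff_add_eq_0)
  then show "frob 1 (z / y) = z / y"
    using psi_map_proportional[OF assms \<open>y \<noteq> 0\<close>, of z] by simp
qed

end

section \<open>The classification\<close>

theorem theorem2p4:
  fixes q t k :: nat
  assumes "primepow q" and "odd q"
    and "t \<ge> 3"
    and "CARD('a::finite_field) = q ^ (2 * t)"
    and "1 \<le> k" and "k < 2 * t"
  shows "scattered q (comp_iter k (psi q t :: 'a poly)) \<longleftrightarrow>
           (even t \<and> gcd k t = 1) \<or>
           (odd t \<and> gcd k (2 * t) = 1 \<and> [q = 1] (mod 4))"
proof -
  interpret psi_field "TYPE('a)" q t
    using assms by unfold_locales auto
  let ?S = "scattered q (comp_iter k (psi q t :: 'a poly))"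
  have gcd_even: "gcd k (2 * t) = 1 \<longleftrightarrow> gcd k t = 1" if "even t"
    using that unfolding coprime_iff_gcd_eq_1[symmetric] coprime_mult_right_iff
    by (auto intro: coprime_divisors[of k k 2 t])
  have q4: "q mod 4 = 1 \<or> q mod 4 = 3"
    using \<open>odd q\<close> by presburger
  have S: "?S \<longleftrightarrow> (\<forall>m. card {x :: 'a. psi_map k x + m * x = 0} \<le> q)"
    using scattered_comp_iter_psi_iff assms by blast
  have "?S \<longleftrightarrow> gcd k (2 * t) = 1 \<and> (even t \<or> q mod 4 = 1)"
  proof
    assume ?S
    then have few: "\<not> (\<exists>m. card {x :: 'a. psi_map k x + m * x = 0} > q)"
      by (auto simp: S not_less)
    then have g: "gcd k (2 * t) = 1"
      using not_scattered_if_common_factor by blast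
    then have "odd k"
      by (rule odd_if_coprime_double)
    then show "gcd k (2 * t) = 1 \<and> (even t \<or> q mod 4 = 1)"
      using g q4 few not_scattered_if_3_mod_4 assms by fastforce
  next
    assume "gcd k (2 * t) = 1 \<and> (even t \<or> q mod 4 = 1)"
    then show ?S
      unfolding S by (intro allI scattered_if_coprime) simp_all
  qed
  then show ?thesis
    using gcd_even by (auto simp: cong_def)
qed

end
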